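(* Let $d\ge 2$, let $q$ be a prime power, and let $s\in\left(\tfrac14,\tfrac12\right]$. Let $P\subset\mathbb{F}_q^d$ be a $(4,s)$-Salem set with $|P|\ll q^{\frac{d}{4s}}$, and let $S$ be a finite set of spheres in $\mathbb{F}_q^d$. Then \[ \left| I(P,S)-\frac{|P|\,|S|}{q}\right| \ll q^{\frac d4}\,|P|^{1-s}\,|S|^{\frac34}. \]
   Context: For $x\in\mathbb{F}_q^d$, $\|x\|:=x_1^2+\cdots+x_d^2$. A sphere in $\mathbb{F}_q^d$ with center $a\in\mathbb{F}_q^d$ and radius $r\in\mathbb{F}_q$ (the case $r=0$ is allowed) is the set $\{x\in\mathbb{F}_q^d:\|x-a\|=r\}$. For a set of points $P$ and a set of spheres $S$, $I(P,S):=|\{(x,\sigma)\in P\times S: x\in\sigma\}|$. For a finite $A\subset\mathbb{F}_q^k$, the additive energy is $\Lambda_4(A):=|\{(x_1,x_2,x_3,x_4)\in A^4: x_1+x_2=x_3+x_4\}|$. A set $A\subset\mathbb{F}_q^k$ is a $(4,s)$-Salem set if $\Lambda_4(A)\le C\big(|A|^{4-4s}+|A|^4/q^k\big)$ for a constant $C$ that may depend on $s,k$ but not on $q$ or $A$. The notation $X\ll Y$ means $X\le CY$ for a constant $C$ independent of $q$, $P$, $S$ (depending only on $d$, $s$ and the implied constants in the hypotheses). *)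

theory Defs
  imports Complex_Main "HOL-Algebra.Ring" "HOL-Algebra.Coset"
begin

text \<open>
  The field is an HOL-Algebra structure \<open>R\<close> (field with finite carrier, \<open>q = order R\<close>) and not a
  type of class \<open>field\<close>, because the implied constants must be uniform in \<open>q\<close>: the quantifier over
  the fields has to stand inside the existential quantifier for the constant.  Every finite field
  is isomorphic to one whose carrier is a set of natural numbers, so taking \<open>'a = nat\<close> in
  a statement about all \<open>R :: 'a ring\<close> yields one constant for all finite fields.

  Vectors of $R^k$ are functions on \<open>{..<k}\<close>, \<open>undefined\<close> elsewhere, so that equality of functions
  is equality of vectors.
\<close>

definition vecs :: "('a, 'b) ring_scheme \<Rightarrow> nat \<Rightarrow> (nat \<Rightarrow> 'a) set" where
  "vecs R k = ({..<k} \<rightarrow>\<^sub>E carrier R)"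

definition vec_add :: "('a, 'b) ring_scheme \<Rightarrow> nat \<Rightarrow> (nat \<Rightarrow> 'a) \<Rightarrow> (nat \<Rightarrow> 'a) \<Rightarrow> (nat \<Rightarrow> 'a)" where
  "vec_add R k x y = (\<lambda>i\<in>{..<k}. x i \<oplus>\<^bsub>R\<^esub> y i)"

definition vec_diff :: "('a, 'b) ring_scheme \<Rightarrow> nat \<Rightarrow> (nat \<Rightarrow> 'a) \<Rightarrow> (nat \<Rightarrow> 'a) \<Rightarrow> (nat \<Rightarrow> 'a)" where
  "vec_diff R k x y = (\<lambda>i\<in>{..<k}. x i \<ominus>\<^bsub>R\<^esub> y i)"

definition vec_norm :: "('a, 'b) ring_scheme \<Rightarrow> nat \<Rightarrow> (nat \<Rightarrow> 'a) \<Rightarrow> 'a" where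
  "vec_norm R k x = (\<Oplus>\<^bsub>R\<^esub>i\<in>{..<k}. x i [^]\<^bsub>R\<^esub> (2::nat))"

definition sphere_at :: "('a, 'b) ring_scheme \<Rightarrow> nat \<Rightarrow> (nat \<Rightarrow> 'a) \<Rightarrow> 'a \<Rightarrow> (nat \<Rightarrow> 'a) set" where
  "sphere_at R k a r = {x \<in> vecs R k. vec_norm R k (vec_diff R k x a) = r}"

text \<open>
  A sphere is a point set, not a pair of a centre and a radius.  In characteristic 2 the norm is the
  square of a linear form, and different centres and radii may give the same sphere.
\<close>

definition spheres :: "('a, 'b) ring_scheme \<Rightarrow> nat \<Rightarrow> (nat \<Rightarrow> 'a) set set" where
  "spheres R k = {sphere_at R k a r | a r. a \<in> vecs R k \<and> r \<in> carrier R}"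

definition incidences :: "'v set \<Rightarrow> 'v set set \<Rightarrow> nat" where
  "incidences P S = card {(x, \<sigma>). x \<in> P \<and> \<sigma> \<in> S \<and> x \<in> \<sigma>}"

definition additive_energy :: "('a, 'b) ring_scheme \<Rightarrow> nat \<Rightarrow> (nat \<Rightarrow> 'a) set \<Rightarrow> nat" where
  "additive_energy R k A =
     card {(x1, x2, x3, x4). x1 \<in> A \<and> x2 \<in> A \<and> x3 \<in> A \<and> x4 \<in> A \<and>
                             vec_add R k x1 x2 = vec_add R k x3 x4}"

text \<open>
  The $(4,s)$-Salem condition with its implied constant \<open>K\<close> made explicit; for a single set the
  condition has no content without the constant.
\<close>

definition salem4 :: "('a, 'b) ring_scheme \<Rightarrow> nat \<Rightarrow> real \<Rightarrow> real \<Rightarrow> (nat \<Rightarrow> 'a) set \<Rightarrow> bool" where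
  "salem4 R k s K A \<longleftrightarrow>
     A \<subseteq> vecs R k \<and>
     real (additive_energy R k A)
       \<le> K * (real (card A) powr (4 - 4 * s) + real (card A) ^ 4 / real (order R) ^ k)"

end

theory Submission
  imports Defs "HOL-Analysis.Convex"
begin

text \<open>
  Write $E$ for the deviation of $I(P,S)$ from $|P||S|/q$, and let $G(a)$ be the number of pairs in
  $P^2$ equidistant from $a$, minus $|P|^2/q$; this is the sum over all radii $r$ of
  $(|P \cap \sigma| - |P|/q)^2$, where $\sigma$ is the sphere with centre $a$ and radius $r$.  Two
  applications of Cauchy-Schwarz give $E^4 \le |S|^3 \sum_a G(a)^2$.

  In odd characteristic the points equidistant from $x \ne y$ form a hyperplane with normal $x - y$.
  When $\sum_a G(a)^2$ is expanded, pairs $(x,y)$, $(z,w)$ with independent normals are uncorrelated,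
  and for every $\lambda \ne 0$ the number of pairs with $z - w = \lambda (x - y)$ is at most the additive
  energy, by $2ab \le a^2 + b^2$.  Hence $\sum_a G(a)^2 \le 4 q^d \Lambda_4(P)$, and no characters are
  needed.  In characteristic 2 distinct spheres are disjoint and $|E| \le |P|$, which the bound on
  $|P|$ makes small enough.
\<close>

section \<open>Counting matching pairs and second moments over finite sets\<close>

lemma card_matching_pairs:
  assumes "finite M" "finite V" "\<And>p. p \<in> M \<Longrightarrow> f p \<in> V"
  shows "card {(p, p'). p \<in> M \<and> p' \<in> M \<and> f p = g p'}
       = (\<Sum>v\<in>V. card {p \<in> M. f p = v} * card {p \<in> M. g p = v})"
proof -
  have "{(p, p'). p \<in> M \<and> p' \<in> M \<and> f p = g p'}
      = (\<Union>v\<in>V. {p \<in> M. f p = v} \<times> {p \<in> M. g p = v})"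
    using assms(3) by (auto) (metis)
  also have "card \<dots> = (\<Sum>v\<in>V. card ({p \<in> M. f p = v} \<times> {p \<in> M. g p = v}))"
    using assms by (intro card_UN_disjoint) auto
  finally show ?thesis by (simp add: card_cartesian_product)
qed

text \<open>Let a_v and b_v be the sizes of the fibres of \<open>f\<close> and \<open>g\<close> over
  v. The three counts are the sums of a_v b_v, a_v^2 and b_v^2, so 2ab <= a^2 + b^2 for each v
  suffices. In the application both counts on the right equal the additive energy.\<close>

lemma card_matching_pairs_le:
  assumes "finite M"
  shows "2 * card {(p, p'). p \<in> M \<and> p' \<in> M \<and> f p = g p'}
       \<le> card {(p, p'). p \<in> M \<and> p' \<in> M \<and> f p = f p'}
         + card {(p, p'). p \<in> M \<and> p' \<in> M \<and> g p = g p'}"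
proof -
  let ?V = "f ` M \<union> g ` M"
  let ?a = "\<lambda>v. card {p \<in> M. f p = v}" and ?b = "\<lambda>v. card {p \<in> M. g p = v}"
  have le: "2 * (a * b) \<le> a * a + b * b" for a b :: nat
  proof -
    have "real (2 * (a * b)) \<le> real (a * a + b * b)"
      using sum_squares_bound[of "real a" "real b"] by (simp add: power2_eq_square)
    then show ?thesis by (simp only: of_nat_le_iff)
  qed
  have "2 * (\<Sum>v\<in>?V. ?a v * ?b v) \<le> (\<Sum>v\<in>?V. ?a v * ?a v) + (\<Sum>v\<in>?V. ?b v * ?b v)"
    unfolding sum_distrib_left sum.distrib[symmetric] by (intro sum_mono le)
  then show ?thesis
    using assms by (simp add: card_matching_pairs[where V = ?V])
qed

text \<open>Second moment method: each \<open>B p\<close> is an event of density \<open>u\<close> in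
  \<open>V\<close>. Expanding the square gives the covariances |B p \<inter> B p'| - u^2 |V|.
  Outside \<open>D\<close> they are at most 0, and on \<open>D\<close> the trivial bound |B p| = u
  |V| is used.\<close>

lemma sum_squares_deviation_le:
  fixes B :: "'p \<Rightarrow> 'v set" and u :: real
  assumes V: "finite V" and M: "finite M" and B: "\<And>p. p \<in> M \<Longrightarrow> B p \<subseteq> V"
    and card_B: "\<And>p. p \<in> M \<Longrightarrow> real (card (B p)) = u * real (card V)"
    and D: "D \<subseteq> M \<times> M" and u: "u \<ge> 0"
    and indep: "\<And>p p'. p \<in> M \<Longrightarrow> p' \<in> M \<Longrightarrow> (p, p') \<notin> D \<Longrightarrow>
                  real (card (B p \<inter> B p')) \<le> u\<^sup>2 * real (card V)"
  shows "(\<Sum>a\<in>V. (\<Sum>p\<in>M. of_bool (a \<in> B p) - u)\<^sup>2) \<le> real (card D) * (u * real (card V))"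
proof -
  have cov: "(\<Sum>a\<in>V. (of_bool (a \<in> B p) - u) * (of_bool (a \<in> B p') - u))
      \<le> of_bool ((p, p') \<in> D) * (u * real (card V))" if p: "p \<in> M" "p' \<in> M" for p p'
  proof -
    have [simp]: "V \<inter> B p = B p" "V \<inter> B p' = B p'"
      "V \<inter> {a \<in> B p. a \<in> B p'} = B p \<inter> B p'"
      using B p by auto
    have "(\<Sum>a\<in>V. (of_bool (a \<in> B p) - u) * (of_bool (a \<in> B p') - u))
        = (\<Sum>a\<in>V. of_bool (a \<in> B p \<and> a \<in> B p') - u * of_bool (a \<in> B p) - u * of_bool (a \<in> B p') + u\<^sup>2)"
      by (intro sum.cong) (auto simp: power2_eq_square algebra_simps)
    also have "\<dots> = real (card (B p \<inter> B p')) - u * real (card (B p)) - u * real (card (B p')) + u\<^sup>2 * real (card V)"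
      using V by (simp add: sum.distrib sum_subtractf mult.commute flip: sum_distrib_left)
    also have "\<dots> = real (card (B p \<inter> B p')) - u\<^sup>2 * real (card V)"
      using card_B p by (simp add: power2_eq_square)
    also have "\<dots> \<le> of_bool ((p, p') \<in> D) * (u * real (card V))"
    proof (cases "(p, p') \<in> D")
      case True
      have "card (B p \<inter> B p') \<le> card (B p)"
        using B[OF p(1)] V by (intro card_mono) (auto intro: finite_subset)
      then have "real (card (B p \<inter> B p')) \<le> u * real (card V)"
        using card_B[OF p(1)] by linarith
      moreover have "u\<^sup>2 * real (card V) \<ge> 0" by simp
      ultimately have "real (card (B p \<inter> B p')) - u\<^sup>2 * real (card V) \<le> u * real (card V)"
        by linarith
      then show ?thesis using True by simp
    qed (use indep p in simp)
    finally show ?thesis .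
  qed
  have "(\<Sum>a\<in>V. (\<Sum>p\<in>M. of_bool (a \<in> B p) - u)\<^sup>2)
      = (\<Sum>a\<in>V. \<Sum>p\<in>M. \<Sum>p'\<in>M. (of_bool (a \<in> B p) - u) * (of_bool (a \<in> B p') - u))"
    by (simp add: power2_eq_square sum_product)
  also have "\<dots> = (\<Sum>p\<in>M. \<Sum>p'\<in>M. \<Sum>a\<in>V. (of_bool (a \<in> B p) - u) * (of_bool (a \<in> B p') - u))"
    by (subst sum.swap) (intro sum.cong sum.swap refl)
  also have "\<dots> \<le> (\<Sum>p\<in>M. \<Sum>p'\<in>M. of_bool ((p, p') \<in> D) * (u * real (card V)))"
    by (intro sum_mono cov)
  also have "\<dots> = (\<Sum>z\<in>M \<times> M. of_bool (z \<in> D)) * (u * real (card V))"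
    by (simp add: sum.cartesian_product sum_distrib_right case_prod_unfold)
  also have "(\<Sum>z\<in>M \<times> M. of_bool (z \<in> D) :: real) = real (card (M \<times> M \<inter> D))"
    using M by simp
  also have "M \<times> M \<inter> D = D" using D by auto
  finally show ?thesis .
qed

text \<open>Both sides equal the sum of the squared fibre sizes minus |P|^2 / |T|, since the fibre
  sizes add up to |P| and their squares count the pairs with equal values. This turns a variance
  over radii into a sum over pairs of points.\<close>

lemma sum_squares_fiber_deviation:
  fixes T :: "'t set"
  assumes P: "finite P" and T: "finite T" "T \<noteq> {}" and n: "\<And>x. x \<in> P \<Longrightarrow> n x \<in> T"
  shows "(\<Sum>r\<in>T. (real (card {x \<in> P. n x = r}) - real (card P) / real (card T))\<^sup>2)
       = (\<Sum>p\<in>P \<times> P. of_bool (n (fst p) = n (snd p)) - 1 / real (card T))"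
proof -
  let ?N = "\<lambda>r. real (card {x \<in> P. n x = r})" and ?q = "real (card T)"
  have q: "?q > 0" using T by (simp add: card_gt_0_iff)
  have "card P = card (\<Union>r\<in>T. {x \<in> P. n x = r})"
    using n by (intro arg_cong[where f = card]) auto
  also have "\<dots> = (\<Sum>r\<in>T. card {x \<in> P. n x = r})"
    using P T by (intro card_UN_disjoint) auto
  finally have sum_N: "(\<Sum>r\<in>T. ?N r) = real (card P)" by simp
  have "P \<times> P \<inter> {p. n (fst p) = n (snd p)} = {(x, y). x \<in> P \<and> y \<in> P \<and> n x = n y}" by auto
  then have sum_N2: "(\<Sum>r\<in>T. ?N r * ?N r) = real (card (P \<times> P \<inter> {p. n (fst p) = n (snd p)}))"
    using card_matching_pairs[OF P T(1), of n n] n by simp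
  have "(\<Sum>r\<in>T. (?N r - real (card P) / ?q)\<^sup>2)
      = (\<Sum>r\<in>T. ?N r * ?N r - 2 * real (card P) / ?q * ?N r + (real (card P) / ?q)\<^sup>2)"
    by (intro sum.cong) (auto simp: power2_eq_square algebra_simps)
  also have "\<dots> = (\<Sum>r\<in>T. ?N r * ?N r) - 2 * real (card P) / ?q * (\<Sum>r\<in>T. ?N r) + ?q * (real (card P) / ?q)\<^sup>2"
    by (simp add: sum.distrib sum_subtractf sum_distrib_left)
  also have "\<dots> = real (card (P \<times> P \<inter> {p. n (fst p) = n (snd p)})) - real (card P) * real (card P) / ?q"
    unfolding sum_N sum_N2 using q by (simp add: power2_eq_square field_simps)
  also have "\<dots> = (\<Sum>p\<in>P \<times> P. of_bool (n (fst p) = n (snd p)) - 1 / ?q)"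
    using P by (simp add: sum_subtractf card_cartesian_product)
  finally show ?thesis .
qed

lemma incidences_eq_sum:
  assumes "finite P" "finite S"
  shows "incidences P S = (\<Sum>\<sigma>\<in>S. card (P \<inter> \<sigma>))"
proof -
  have "{(x, \<sigma>). x \<in> P \<and> \<sigma> \<in> S \<and> x \<in> \<sigma>} = prod.swap ` (SIGMA \<sigma>:S. P \<inter> \<sigma>)"
    by auto
  then have "incidences P S = card (SIGMA \<sigma>:S. P \<inter> \<sigma>)"
    by (simp add: incidences_def card_image)
  also have "\<dots> = (\<Sum>\<sigma>\<in>S. card (P \<inter> \<sigma>))"
    using assms by (intro card_SigmaI) auto
  finally show ?thesis .
qed

lemma square_mult_one_minus_inverse_le:
  fixes x q :: real
  assumes "q \<ge> 1"
  shows "(x * (1 - 1 / q))\<^sup>2 \<le> x\<^sup>2"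
proof -
  have "0 \<le> 1 / q" "1 / q \<le> 1" using assms by auto
  then have "(1 - 1 / q)\<^sup>2 \<le> 1" by (intro power_le_one) auto
  then show ?thesis by (simp add: power_mult_distrib mult_left_le)
qed

lemma square_add_le:
  fixes x y :: real
  shows "(x + y)\<^sup>2 \<le> 2 * x\<^sup>2 + 2 * y\<^sup>2"
  using sum_squares_bound[of x y] by (simp add: power2_sum)

section \<open>Vectors over a finite field\<close>

locale finite_field = field R for R (structure) +
  assumes finite_carrier [simp]: "finite (carrier R)"
begin

definition vec_dot :: "nat \<Rightarrow> (nat \<Rightarrow> 'a) \<Rightarrow> (nat \<Rightarrow> 'a) \<Rightarrow> 'a" where
  "vec_dot k v a = (\<Oplus>i\<in>{..<k}. v i \<otimes> a i)"

definition vec_scale :: "nat \<Rightarrow> 'a \<Rightarrow> (nat \<Rightarrow> 'a) \<Rightarrow> (nat \<Rightarrow> 'a)" where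
  "vec_scale k c x = (\<lambda>i\<in>{..<k}. c \<otimes> x i)"

definition hyperplane :: "nat \<Rightarrow> (nat \<Rightarrow> 'a) \<Rightarrow> 'a \<Rightarrow> (nat \<Rightarrow> 'a) set" where
  "hyperplane k v c = {a \<in> vecs R k. vec_dot k v a = c}"

lemma diff_eq_zero_iff: "a \<in> carrier R \<Longrightarrow> b \<in> carrier R \<Longrightarrow> a \<ominus> b = \<zero> \<longleftrightarrow> a = b"
proof
  assume ab: "a \<in> carrier R" "b \<in> carrier R" and "a \<ominus> b = \<zero>"
  moreover have "(a \<ominus> b) \<oplus> b = a" using ab by (simp add: a_minus_def a_assoc l_neg)
  ultimately show "a = b" by simp
qed (simp add: a_minus_def r_neg)

lemma square_diff:
  assumes "x \<in> carrier R" "a \<in> carrier R"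
  shows "(x \<ominus> a) [^] (2::nat) \<oplus> (\<one> \<oplus> \<one>) \<otimes> (x \<otimes> a) = x [^] (2::nat) \<oplus> a [^] (2::nat)"
  using assms unfolding numeral_2_eq_2 nat_pow_Suc nat_pow_0 by algebra

lemma diff_mult_add:
  assumes "x \<in> carrier R" "y \<in> carrier R" "a \<in> carrier R"
  shows "(x \<ominus> y) \<otimes> a \<oplus> y \<otimes> a = x \<otimes> a"
  using assms by algebra

lemma mult_add_diff:
  assumes "v \<in> carrier R" "a \<in> carrier R" "b \<in> carrier R"
  shows "v \<otimes> b \<oplus> v \<otimes> (a \<ominus> b) = v \<otimes> a"
  using assms by algebra

text \<open>Applying the adjugate of the coefficient matrix expresses determinant times unknown as a
  combination of the two left-hand sides, which vanish. The determinant is not zero and a field has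
  no zero divisors.\<close>

lemma cramer:
  assumes "p \<in> carrier R" "q \<in> carrier R" "u \<in> carrier R" "w \<in> carrier R"
    and "s \<in> carrier R" "t \<in> carrier R"
    and e1: "p \<otimes> s \<oplus> q \<otimes> t = \<zero>" and e2: "u \<otimes> s \<oplus> w \<otimes> t = \<zero>"
    and minor: "p \<otimes> w \<noteq> q \<otimes> u"
  shows "s = \<zero>" "t = \<zero>"
proof -
  have "(p \<otimes> w \<ominus> q \<otimes> u) \<otimes> s
      \<ominus> (w \<otimes> (p \<otimes> s \<oplus> q \<otimes> t) \<ominus> q \<otimes> (u \<otimes> s \<oplus> w \<otimes> t)) = \<zero>"
    using assms(1-6) by algebra
  moreover have "(p \<otimes> w \<ominus> q \<otimes> u) \<otimes> t
      \<ominus> (p \<otimes> (u \<otimes> s \<oplus> w \<otimes> t) \<ominus> u \<otimes> (p \<otimes> s \<oplus> q \<otimes> t)) = \<zero>"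
    using assms(1-6) by algebra
  moreover have "p \<otimes> w \<ominus> q \<otimes> u \<noteq> \<zero>"
    using minor assms(1-4) by (simp add: diff_eq_zero_iff)
  moreover have "\<zero> \<ominus> \<zero> = \<zero>" by (simp add: a_minus_def)
  ultimately show "s = \<zero>" "t = \<zero>"
    using assms(1-6) unfolding e1 e2 by (simp_all add: integral_iff diff_eq_zero_iff)
qed

lemma order_pos: "order R > 0"
  using finite_carrier zero_closed by (auto simp: order_def card_gt_0_iff)

lemma vecs_nth [simp, intro]: "x \<in> vecs R k \<Longrightarrow> i < k \<Longrightarrow> x i \<in> carrier R"
  by (auto simp: vecs_def)

lemma vecs_eqI:
  "x \<in> vecs R k \<Longrightarrow> y \<in> vecs R k \<Longrightarrow> (\<And>i. i < k \<Longrightarrow> x i = y i) \<Longrightarrow> x = y"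
  unfolding vecs_def by (rule PiE_ext) auto

lemma finite_vecs [simp]: "finite (vecs R k)"
  by (auto simp: vecs_def intro: finite_PiE)

lemma card_vecs: "card (vecs R k) = order R ^ k"
  by (simp add: vecs_def card_PiE order_def)

lemma vec_diff_closed [simp, intro]:
  "x \<in> vecs R k \<Longrightarrow> y \<in> vecs R k \<Longrightarrow> vec_diff R k x y \<in> vecs R k"
  by (auto simp: vecs_def vec_diff_def)

lemma vec_scale_closed [simp, intro]:
  "c \<in> carrier R \<Longrightarrow> x \<in> vecs R k \<Longrightarrow> vec_scale k c x \<in> vecs R k"
  by (auto simp: vecs_def vec_scale_def)

lemma vec_dot_closed [simp, intro]:
  "x \<in> vecs R k \<Longrightarrow> y \<in> vecs R k \<Longrightarrow> vec_dot k x y \<in> carrier R"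
  by (auto simp: vec_dot_def intro!: finsum_closed)

lemma vec_norm_closed [simp, intro]: "x \<in> vecs R k \<Longrightarrow> vec_norm R k x \<in> carrier R"
  by (auto simp: vec_norm_def intro!: finsum_closed)

text \<open>The cross term stands on the left, so the expansion is a coordinatewise identity of
  sums. It serves both characteristics: where 2 is invertible it yields hyperplanes, and where 2 = 0
  the cross term disappears and the norm is additive.\<close>

lemma vec_norm_diff:
  assumes x: "x \<in> vecs R k" and a: "a \<in> vecs R k"
  shows "vec_norm R k (vec_diff R k x a) \<oplus> (\<one> \<oplus> \<one>) \<otimes> vec_dot k x a
       = vec_norm R k x \<oplus> vec_norm R k a"
proof -
  have "vec_norm R k (vec_diff R k x a) = (\<Oplus>i\<in>{..<k}. (x i \<ominus> a i) [^] (2::nat))"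
    unfolding vec_norm_def vec_diff_def using x a by (intro finsum_cong') auto
  then have "vec_norm R k (vec_diff R k x a) \<oplus> (\<one> \<oplus> \<one>) \<otimes> vec_dot k x a
      = (\<Oplus>i\<in>{..<k}. (x i \<ominus> a i) [^] (2::nat) \<oplus> (\<one> \<oplus> \<one>) \<otimes> (x i \<otimes> a i))"
    using x a unfolding vec_dot_def
    by (subst finsum_addf) (auto simp: finsum_rdistr Pi_iff)
  also have "\<dots> = (\<Oplus>i\<in>{..<k}. x i [^] (2::nat) \<oplus> a i [^] (2::nat))"
  proof (rule finsum_cong')
    fix i assume "i \<in> {..<k}"
    then show "(x i \<ominus> a i) [^] (2::nat) \<oplus> (\<one> \<oplus> \<one>) \<otimes> (x i \<otimes> a i)
        = x i [^] (2::nat) \<oplus> a i [^] (2::nat)"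
      using x a by (intro square_diff) auto
  qed (use x a in auto)
  also have "\<dots> = vec_norm R k x \<oplus> vec_norm R k a"
    using x a unfolding vec_norm_def by (subst finsum_addf) (auto simp: Pi_iff)
  finally show ?thesis .
qed

lemma vec_dot_diff:
  assumes "x \<in> vecs R k" "y \<in> vecs R k" "a \<in> vecs R k"
  shows "vec_dot k (vec_diff R k x y) a = vec_dot k x a \<ominus> vec_dot k y a"
proof -
  have "vec_dot k (vec_diff R k x y) a = (\<Oplus>i\<in>{..<k}. (x i \<ominus> y i) \<otimes> a i)"
    unfolding vec_dot_def vec_diff_def using assms by (intro finsum_cong') auto
  then have "vec_dot k (vec_diff R k x y) a \<oplus> vec_dot k y a
      = (\<Oplus>i\<in>{..<k}. (x i \<ominus> y i) \<otimes> a i \<oplus> y i \<otimes> a i)"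
    using assms unfolding vec_dot_def by (subst finsum_addf) (auto simp: Pi_iff)
  also have "\<dots> = vec_dot k x a"
    unfolding vec_dot_def
  proof (rule finsum_cong')
    fix i assume "i \<in> {..<k}"
    then show "(x i \<ominus> y i) \<otimes> a i \<oplus> y i \<otimes> a i = x i \<otimes> a i"
      using assms by (intro diff_mult_add) auto
  qed (use assms in auto)
  finally have "vec_dot k x a \<ominus> vec_dot k y a
      = (vec_dot k (vec_diff R k x y) a \<oplus> vec_dot k y a) \<ominus> vec_dot k y a"
    by simp
  also have "\<dots> = vec_dot k (vec_diff R k x y) a"
    using assms by (simp add: a_minus_def a_assoc r_neg)
  finally show ?thesis by simp
qed

section \<open>Sizes of hyperplanes and of their intersections\<close>

text \<open>The dot product of \<open>v\<close> with a - b is 0 and its terms outside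
  \<open>T\<close> vanish. With \<open>T\<close> of size one or two, this leaves a linear equation
  in the few coordinates where \<open>a\<close> and \<open>b\<close> may still differ.\<close>

lemma vec_dot_cong_off:
  assumes v: "v \<in> vecs R k" and a: "a \<in> vecs R k" and b: "b \<in> vecs R k" and T: "T \<subseteq> {..<k}"
    and eq: "\<And>i. i < k \<Longrightarrow> i \<notin> T \<Longrightarrow> a i = b i" and dot: "vec_dot k v a = vec_dot k v b"
  shows "(\<Oplus>i\<in>T. v i \<otimes> (a i \<ominus> b i)) = \<zero>"
proof -
  have fT: "finite T" using T finite_subset by blast
  have c: "v i \<in> carrier R" "a i \<in> carrier R" "b i \<in> carrier R" if "i < k" for i
    using that v a b by auto
  have "vec_dot k v b \<oplus> (\<Oplus>i\<in>{..<k}. v i \<otimes> (a i \<ominus> b i))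
      = (\<Oplus>i\<in>{..<k}. v i \<otimes> b i \<oplus> v i \<otimes> (a i \<ominus> b i))"
    unfolding vec_dot_def using c by (subst finsum_addf) (auto simp: Pi_iff)
  also have "\<dots> = vec_dot k v a"
    unfolding vec_dot_def
  proof (rule finsum_cong')
    fix i assume "i \<in> {..<k}"
    then show "v i \<otimes> b i \<oplus> v i \<otimes> (a i \<ominus> b i) = v i \<otimes> a i"
      using c by (intro mult_add_diff) auto
  qed (use c in auto)
  finally have "vec_dot k v b \<oplus> (\<Oplus>i\<in>{..<k}. v i \<otimes> (a i \<ominus> b i)) = vec_dot k v b"
    using dot by simp
  moreover have "(\<Oplus>i\<in>{..<k}. v i \<otimes> (a i \<ominus> b i)) \<in> carrier R" "vec_dot k v b \<in> carrier R"
    using c v b by (auto intro!: finsum_closed)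
  ultimately have "(\<Oplus>i\<in>{..<k}. v i \<otimes> (a i \<ominus> b i)) = \<zero>"
    by (metis add.l_cancel_one')
  moreover have "(\<Oplus>i\<in>T. v i \<otimes> (a i \<ominus> b i)) = (\<Oplus>i\<in>{..<k}. v i \<otimes> (a i \<ominus> b i))"
  proof (rule add.finprod_mono_neutral_cong_left)
    fix i assume "i \<in> {..<k} - T"
    then show "v i \<otimes> (a i \<ominus> b i) = \<zero>" using eq c by (auto simp: a_minus_def r_neg)
  qed (use T c in \<open>auto simp: Pi_iff\<close>)
  ultimately show ?thesis by simp
qed

text \<open>Restriction to the coordinates outside \<open>T\<close> is injective on
  \<open>A\<close>, and there are k - |T| of these.\<close>

lemma card_le_if_determined_off:
  assumes A: "A \<subseteq> vecs R k" and T: "T \<subseteq> {..<k}"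
    and det: "\<And>a b. a \<in> A \<Longrightarrow> b \<in> A \<Longrightarrow> (\<And>i. i < k \<Longrightarrow> i \<notin> T \<Longrightarrow> a i = b i) \<Longrightarrow> a = b"
  shows "card A \<le> order R ^ (k - card T)"
proof -
  let ?r = "\<lambda>a. restrict a ({..<k} - T)"
  have "inj_on ?r A"
  proof (rule inj_onI)
    fix a b assume ab: "a \<in> A" "b \<in> A" and eq: "?r a = ?r b"
    show "a = b"
    proof (rule det[OF ab])
      fix i assume "i < k" "i \<notin> T"
      then show "a i = b i" using fun_cong[OF eq, of i] by simp
    qed
  qed
  moreover have "?r ` A \<subseteq> ({..<k} - T) \<rightarrow>\<^sub>E carrier R"
    using A unfolding image_subset_iff restrict_PiE_iff by (blast intro: vecs_nth)
  ultimately have "card A \<le> card (({..<k} - T) \<rightarrow>\<^sub>E carrier R)"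
    by (intro card_inj_on_le) (auto intro!: finite_PiE)
  also have "\<dots> = order R ^ (k - card T)"
    using T by (simp add: card_PiE order_def card_Diff_subset finite_subset)
  finally show ?thesis .
qed

text \<open>The coordinate at which \<open>v\<close> is nonzero is determined by all the
  others.\<close>

lemma card_hyperplane_le:
  assumes v: "v \<in> vecs R k" and i: "i < k" "v i \<noteq> \<zero>"
  shows "card (hyperplane k v c) \<le> order R ^ (k - 1)"
proof -
  have "card (hyperplane k v c) \<le> order R ^ (k - card {i})"
  proof (rule card_le_if_determined_off)
    fix a b assume a: "a \<in> hyperplane k v c" and b: "b \<in> hyperplane k v c"
      and eq: "\<And>j. j < k \<Longrightarrow> j \<notin> {i} \<Longrightarrow> a j = b j"
    have ab: "a \<in> vecs R k" "b \<in> vecs R k" "vec_dot k v a = vec_dot k v b"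
      using a b by (auto simp: hyperplane_def)
    have c: "v i \<in> carrier R" "a i \<in> carrier R" "b i \<in> carrier R" using ab v i by auto
    have "(\<Oplus>j\<in>{i}. v j \<otimes> (a j \<ominus> b j)) = \<zero>"
      by (rule vec_dot_cong_off[OF v ab(1,2) _ eq ab(3)]) (use i in auto)
    then have "v i \<otimes> (a i \<ominus> b i) = \<zero>"
      using c by (subst (asm) finsum_insert) auto
    then have "a i = b i"
      using c i by (simp add: integral_iff diff_eq_zero_iff)
    then show "a = b" using ab eq by (intro vecs_eqI) auto
  qed (use i in \<open>auto simp: hyperplane_def\<close>)
  then show ?thesis by simp
qed

text \<open>The q parallel hyperplanes partition the q^k vectors and each has at most q^(k-1)
  points, so a single smaller one would make the total too small.\<close>

lemma card_hyperplane:
  assumes v: "v \<in> vecs R k" and i: "i < k" "v i \<noteq> \<zero>" and c: "c \<in> carrier R"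
  shows "card (hyperplane k v c) = order R ^ (k - 1)"
proof (rule ccontr)
  assume "card (hyperplane k v c) \<noteq> order R ^ (k - 1)"
  then have less: "card (hyperplane k v c) < order R ^ (k - 1)"
    using card_hyperplane_le[OF v i] by (simp add: le_neq_implies_less)
  have "order R ^ k = card (\<Union>c\<in>carrier R. hyperplane k v c)"
    unfolding card_vecs[symmetric] using v by (intro arg_cong[where f = card]) (auto simp: hyperplane_def)
  also have "\<dots> = (\<Sum>c\<in>carrier R. card (hyperplane k v c))"
    by (rule card_UN_disjoint) (auto simp: hyperplane_def)
  also have "\<dots> < (\<Sum>c\<in>carrier R. order R ^ (k - 1))"
    by (rule sum_strict_mono_ex1) (use c less card_hyperplane_le[OF v i] in auto)
  also have "\<dots> = order R ^ k"
    using i by (simp add: order_def flip: power_Suc)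
  finally show False by simp
qed

text \<open>By Cramer's rule a nonzero 2 x 2 minor lets the remaining coordinates determine those at
  \<open>i\<close> and \<open>j\<close>. An upper bound is exactly what the second moment estimate
  asks of an uncorrelated pair.\<close>

lemma card_hyperplane_Int_le:
  assumes v: "v \<in> vecs R k" and w: "w \<in> vecs R k" and i: "i < k" and j: "j < k"
    and minor: "v i \<otimes> w j \<noteq> v j \<otimes> w i"
  shows "card (hyperplane k v c \<inter> hyperplane k w e) \<le> order R ^ (k - 2)"
proof -
  have "i \<noteq> j" using minor by auto
  then have "card {i, j} = 2" by simp
  have "card (hyperplane k v c \<inter> hyperplane k w e) \<le> order R ^ (k - card {i, j})"
  proof (rule card_le_if_determined_off)
    fix a b assume a: "a \<in> hyperplane k v c \<inter> hyperplane k w e"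
      and b: "b \<in> hyperplane k v c \<inter> hyperplane k w e"
      and eq: "\<And>l. l < k \<Longrightarrow> l \<notin> {i, j} \<Longrightarrow> a l = b l"
    have ab: "a \<in> vecs R k" "b \<in> vecs R k"
      and dots: "vec_dot k v a = vec_dot k v b" "vec_dot k w a = vec_dot k w b"
      using a b by (auto simp: hyperplane_def)
    have cl: "v i \<in> carrier R" "v j \<in> carrier R" "w i \<in> carrier R" "w j \<in> carrier R"
      "a i \<in> carrier R" "a j \<in> carrier R" "b i \<in> carrier R" "b j \<in> carrier R"
      using ab v w i j by auto
    define s t where "s = a i \<ominus> b i" and "t = a j \<ominus> b j"
    have st: "s \<in> carrier R" "t \<in> carrier R" using cl by (auto simp: s_def t_def)
    have eqn: "u i \<otimes> s \<oplus> u j \<otimes> t = \<zero>"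
      if u: "u \<in> vecs R k" and d: "vec_dot k u a = vec_dot k u b" for u
    proof -
      have "(\<Oplus>l\<in>{i, j}. u l \<otimes> (a l \<ominus> b l)) = \<zero>"
        by (rule vec_dot_cong_off[OF u ab _ eq d]) (use i j in auto)
      moreover have "u i \<in> carrier R" "u j \<in> carrier R" using u i j by auto
      ultimately show ?thesis
        using \<open>i \<noteq> j\<close> cl by (simp add: s_def t_def Pi_iff)
    qed
    note e1 = eqn[OF v dots(1)] and e2 = eqn[OF w dots(2)]
    have "s = \<zero>" "t = \<zero>"
      using cramer[OF cl(1-4) st e1 e2 minor] by auto
    then have "a i = b i" "a j = b j"
      using cl by (simp_all add: s_def t_def diff_eq_zero_iff)
    then show "a = b" using ab eq by (intro vecs_eqI) auto
  qed (use i j in \<open>auto simp: hyperplane_def\<close>)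
  then show ?thesis using \<open>card {i, j} = 2\<close> by simp
qed

text \<open>If all minors involving column \<open>i\<close> vanish, then w m = (w i / v i) v m for
  every m. The factor is nonzero because \<open>w\<close> is.\<close>

lemma parallel_or_minor:
  assumes v: "v \<in> vecs R k" and w: "w \<in> vecs R k" and i: "i < k" "v i \<noteq> \<zero>"
    and j: "j < k" "w j \<noteq> \<zero>"
  obtains l where "l \<in> carrier R - {\<zero>}" "w = vec_scale k l v"
  | i' j' where "i' < k" "j' < k" "v i' \<otimes> w j' \<noteq> v j' \<otimes> w i'"
proof (cases "\<forall>m<k. v i \<otimes> w m = v m \<otimes> w i")
  case True
  have vi: "v i \<in> Units R" using v i by (auto simp: field_Units)
  define l where "l = inv (v i) \<otimes> w i"
  have l: "l \<in> carrier R" using vi w i by (auto simp: l_def)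
  have eq: "w m = l \<otimes> v m" if m: "m < k" for m
  proof -
    have c: "w m \<in> carrier R" "v m \<in> carrier R" "w i \<in> carrier R" "v i \<in> carrier R"
      "inv (v i) \<in> carrier R"
      using v w i m vi by auto
    have "w m = inv (v i) \<otimes> (v i \<otimes> w m)"
      using c vi by (simp add: m_assoc[symmetric])
    also have "\<dots> = inv (v i) \<otimes> (v m \<otimes> w i)" using True m by simp
    also have "\<dots> = l \<otimes> v m" unfolding l_def using c by (simp add: m_ac)
    finally show ?thesis .
  qed
  have "l \<noteq> \<zero>" using eq[OF j(1)] j v by auto
  moreover have "w = vec_scale k l v"
    using eq by (intro vecs_eqI[OF w vec_scale_closed[OF l v]]) (simp add: vec_scale_def)
  ultimately show ?thesis using l that(1) by blast
next
  case False
  then show ?thesis using i that(2) by blast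
qed

lemma vec_diff_nonzero:
  assumes "x \<in> vecs R k" "y \<in> vecs R k" "x \<noteq> y"
  obtains i where "i < k" "vec_diff R k x y i \<noteq> \<zero>"
proof -
  obtain i where i: "i < k" "x i \<noteq> y i" using assms vecs_eqI by blast
  then have "vec_diff R k x y i \<noteq> \<zero>" using assms by (auto simp: vec_diff_def diff_eq_zero_iff)
  then show ?thesis using that i by blast
qed

section \<open>Bisectors of pairs of points\<close>

definition bisector :: "nat \<Rightarrow> (nat \<Rightarrow> 'a) \<times> (nat \<Rightarrow> 'a) \<Rightarrow> (nat \<Rightarrow> 'a) set" where
  "bisector k p = {a \<in> vecs R k. vec_norm R k (vec_diff R k (fst p) a) = vec_norm R k (vec_diff R k (snd p) a)}"

text \<open>In the difference of the two norm expansions the norm of the centre a cancels, which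
  leaves 2 (x - y) . a = |x| - |y| with |.| the norm; division by 2 gives the constant.\<close>

lemma bisector_hyperplane:
  assumes odd: "\<one> \<oplus> \<one> \<noteq> \<zero>" and x: "x \<in> vecs R k" and y: "y \<in> vecs R k"
  obtains c where "c \<in> carrier R" "bisector k (x, y) = hyperplane k (vec_diff R k x y) c"
proof -
  let ?n = "vec_norm R k" let ?t = "\<one> \<oplus> \<one>"
  have t: "?t \<in> Units R" using odd by (simp add: field_Units)
  define c where "c = inv ?t \<otimes> (?n x \<ominus> ?n y)"
  have c: "c \<in> carrier R" using t x y by (auto simp: c_def)
  have tc: "?t \<otimes> c = ?n x \<ominus> ?n y"
    unfolding c_def using t x y by (simp add: m_assoc[symmetric] Units_r_inv)
  have "(?n (vec_diff R k x a) = ?n (vec_diff R k y a)) \<longleftrightarrow> vec_dot k (vec_diff R k x y) a = c"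
    if a: "a \<in> vecs R k" for a
  proof -
    define A B X Y N D E where "A = ?n (vec_diff R k x a)" and "B = ?n (vec_diff R k y a)"
      and "X = ?n x" and "Y = ?n y" and "N = ?n a" and "D = vec_dot k x a" and "E = vec_dot k y a"
    have cl: "A \<in> carrier R" "B \<in> carrier R" "X \<in> carrier R" "Y \<in> carrier R" "N \<in> carrier R"
      "D \<in> carrier R" "E \<in> carrier R"
      using x y a by (auto simp: A_def B_def X_def Y_def N_def D_def E_def)
    have 1: "A \<oplus> ?t \<otimes> D = X \<oplus> N"
      using vec_norm_diff[OF x a] by (simp add: A_def X_def N_def D_def)
    have 2: "B \<oplus> ?t \<otimes> E = Y \<oplus> N"
      using vec_norm_diff[OF y a] by (simp add: B_def Y_def N_def E_def)
    have "X = ?t \<otimes> c \<oplus> Y"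
      using tc cl by (simp add: X_def Y_def a_minus_def a_assoc l_neg)
    \<comment> \<open>The two expansions are added crosswise instead of subtracted, so that
      \<open>N\<close> cancels from both sides. In the resulting equation A = B holds exactly when
      the terms 2 D and 2 (c + E) agree.\<close>
    have "N \<oplus> (A \<oplus> (?t \<otimes> D \<oplus> Y)) = (A \<oplus> ?t \<otimes> D) \<oplus> (Y \<oplus> N)"
      using cl by (simp add: a_ac)
    also have "\<dots> = (X \<oplus> N) \<oplus> (B \<oplus> ?t \<otimes> E)" unfolding 1 2 ..
    also have "\<dots> = N \<oplus> (B \<oplus> (?t \<otimes> (c \<oplus> E) \<oplus> Y))"
      unfolding \<open>X = ?t \<otimes> c \<oplus> Y\<close> using cl c by (simp add: a_ac r_distr)
    finally have eq: "A \<oplus> (?t \<otimes> D \<oplus> Y) = B \<oplus> (?t \<otimes> (c \<oplus> E) \<oplus> Y)"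
      using cl c by simp
    have "A = B \<longleftrightarrow> A \<oplus> (?t \<otimes> (c \<oplus> E) \<oplus> Y) = B \<oplus> (?t \<otimes> (c \<oplus> E) \<oplus> Y)"
      using cl c by (intro add.right_cancel[symmetric]) auto
    also have "\<dots> \<longleftrightarrow> c \<oplus> E = D"
      unfolding eq[symmetric] using cl c odd by (simp add: m_lcancel)
    also have "\<dots> \<longleftrightarrow> c = D \<ominus> E"
      using cl c by (auto simp: a_minus_def a_assoc l_neg r_neg)
    finally have "A = B \<longleftrightarrow> c = D \<ominus> E" .
    then show ?thesis
      unfolding vec_dot_diff[OF x y a] A_def[symmetric] B_def[symmetric] D_def[symmetric]
        E_def[symmetric] by auto
  qed
  then have "bisector k (x, y) = hyperplane k (vec_diff R k x y) c"
    by (auto simp: bisector_def hyperplane_def)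
  with c that show ?thesis by blast
qed

section \<open>Additive energy in terms of differences\<close>

lemma vec_add_eq_iff_vec_diff_eq:
  assumes "x \<in> vecs R k" "w \<in> vecs R k" "y \<in> vecs R k" "z \<in> vecs R k"
  shows "vec_add R k x w = vec_add R k y z \<longleftrightarrow> vec_diff R k x y = vec_diff R k z w"
proof -
  have "a \<oplus> d = b \<oplus> c \<longleftrightarrow> a \<ominus> b = c \<ominus> d"
    if cl: "a \<in> carrier R" "b \<in> carrier R" "c \<in> carrier R" "d \<in> carrier R" for a b c d
  proof -
    have "((a \<oplus> d) \<ominus> (b \<oplus> c)) \<ominus> ((a \<ominus> b) \<ominus> (c \<ominus> d)) = \<zero>" using cl by algebra
    then have "(a \<oplus> d) \<ominus> (b \<oplus> c) = (a \<ominus> b) \<ominus> (c \<ominus> d)" using cl by (simp add: diff_eq_zero_iff)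
    then show ?thesis using cl diff_eq_zero_iff by (metis add.m_closed minus_closed)
  qed
  note coord = this
  have "vec_add R k x w = vec_add R k y z \<longleftrightarrow> (\<forall>i<k. x i \<oplus> w i = y i \<oplus> z i)"
    by (auto simp: vec_add_def restrict_def fun_eq_iff)
  also have "\<dots> \<longleftrightarrow> (\<forall>i<k. x i \<ominus> y i = z i \<ominus> w i)"
    using assms coord by auto
  also have "\<dots> \<longleftrightarrow> vec_diff R k x y = vec_diff R k z w"
    by (auto simp: vec_diff_def restrict_def fun_eq_iff)
  finally show ?thesis .
qed

text \<open>The quadruple x + w = y + z is regrouped as x - y = z - w. The energy then becomes a
  count of matching pairs for the single map taking a pair to its difference, to which
  \<open>card_matching_pairs_le\<close> applies.\<close>

lemma additive_energy_eq:
  assumes P: "P \<subseteq> vecs R k"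
  shows "additive_energy R k P = card {(p, p'). p \<in> P \<times> P \<and> p' \<in> P \<times> P \<and>
           vec_diff R k (fst p) (snd p) = vec_diff R k (fst p') (snd p')}"
proof -
  let ?f = "\<lambda>((x, y), (z, w)). (x, w, y, z)"
  let ?Q = "{(p, p'). p \<in> P \<times> P \<and> p' \<in> P \<times> P \<and>
           vec_diff R k (fst p) (snd p) = vec_diff R k (fst p') (snd p')}"
  have iff: "vec_add R k x w = vec_add R k y z \<longleftrightarrow> vec_diff R k x y = vec_diff R k z w"
    if "x \<in> P" "w \<in> P" "y \<in> P" "z \<in> P" for x w y z
    using that P by (intro vec_add_eq_iff_vec_diff_eq) auto
  have "bij_betw ?f ?Q {(x1, x2, x3, x4). x1 \<in> P \<and> x2 \<in> P \<and> x3 \<in> P \<and> x4 \<in> P \<and>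
                             vec_add R k x1 x2 = vec_add R k x3 x4}"
    by (rule bij_betwI[where g = "\<lambda>(x, w, y, z). ((x, y), (z, w))"]) (auto simp: iff)
  then show ?thesis unfolding additive_energy_def by (rule bij_betw_same_card[symmetric])
qed

text \<open>The trivial solutions, in which both pairs coincide, already number |P|^2. This later
  absorbs the contribution of the pairs (x, x).\<close>

lemma card_square_le_additive_energy:
  assumes P: "P \<subseteq> vecs R k"
  shows "(card P)\<^sup>2 \<le> additive_energy R k P"
proof -
  have fin: "finite P" using P finite_vecs finite_subset by blast
  have "(card P)\<^sup>2 = card ((\<lambda>p. (p, p)) ` (P \<times> P))"
    unfolding power2_eq_square by (simp add: card_image inj_on_def card_cartesian_product)
  also have "\<dots> \<le> additive_energy R k P"
    unfolding additive_energy_eq[OF P]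
    by (rule card_mono[OF finite_subset[of _ "(P \<times> P) \<times> (P \<times> P)"]]) (use fin in auto)
  finally show ?thesis .
qed

lemma inj_on_vec_scale:
  assumes l: "l \<in> carrier R - {\<zero>}"
  shows "inj_on (vec_scale k l) (vecs R k)"
proof (rule inj_onI)
  fix x y assume x: "x \<in> vecs R k" and y: "y \<in> vecs R k" and eq: "vec_scale k l x = vec_scale k l y"
  show "x = y"
  proof (rule vecs_eqI[OF x y])
    fix i assume i: "i < k"
    then have "l \<otimes> x i = l \<otimes> y i" using fun_cong[OF eq, of i] by (simp add: vec_scale_def)
    then show "x i = y i" using l x y i m_lcancel by auto
  qed
qed

text \<open>For a fixed ratio \<open>l\<close> the count compares the scaled difference of one pair
  with the plain difference of the other. Scaling by \<open>l\<close> is injective, so both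
  self-counts in \<open>card_matching_pairs_le\<close> equal the energy. Then the at most q ratios
  are summed.\<close>

lemma card_parallel_pairs_le:
  assumes P: "P \<subseteq> vecs R k"
  shows "card {(p, p'). p \<in> P \<times> P \<and> p' \<in> P \<times> P \<and> (\<exists>l\<in>carrier R - {\<zero>}.
           vec_diff R k (fst p') (snd p') = vec_scale k l (vec_diff R k (fst p) (snd p)))}
         \<le> order R * additive_energy R k P"
proof -
  let ?d = "\<lambda>p. vec_diff R k (fst p) (snd p)"
  let ?E = "\<lambda>l. {(p, p'). p \<in> P \<times> P \<and> p' \<in> P \<times> P \<and> vec_scale k l (?d p) = ?d p'}"
  have fin: "finite P" using P finite_vecs finite_subset by blast
  have E: "card (?E l) \<le> additive_energy R k P" if l: "l \<in> carrier R - {\<zero>}" for l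
  proof -
    have "{(p, p'). p \<in> P \<times> P \<and> p' \<in> P \<times> P \<and> vec_scale k l (?d p) = vec_scale k l (?d p')}
        = {(p, p'). p \<in> P \<times> P \<and> p' \<in> P \<times> P \<and> ?d p = ?d p'}"
    proof -
      have "vec_scale k l (?d p) = vec_scale k l (?d p') \<longleftrightarrow> ?d p = ?d p'"
        if "p \<in> P \<times> P" "p' \<in> P \<times> P" for p p'
        using that P by (intro inj_on_eq_iff[OF inj_on_vec_scale[OF l]] vec_diff_closed) auto
      then show ?thesis by blast
    qed
    then show ?thesis
      using card_matching_pairs_le[of "P \<times> P" "\<lambda>p. vec_scale k l (?d p)" ?d] fin
      by (simp add: additive_energy_eq[OF P])
  qed
  have "{(p, p'). p \<in> P \<times> P \<and> p' \<in> P \<times> P \<and> (\<exists>l\<in>carrier R - {\<zero>}. ?d p' = vec_scale k l (?d p))}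
      = (\<Union>l\<in>carrier R - {\<zero>}. ?E l)"
    by (auto, metis DiffI empty_iff insert_iff)
  also have "card \<dots> \<le> (\<Sum>l\<in>carrier R - {\<zero>}. card (?E l))"
    by (rule card_UN_le) simp
  also have "\<dots> \<le> (\<Sum>l\<in>carrier R - {\<zero>}. additive_energy R k P)"
    by (intro sum_mono E)
  also have "\<dots> \<le> order R * additive_energy R k P"
    by (simp add: order_def card_Diff_subset)
  finally show ?thesis .
qed

section \<open>The incidence bound in odd characteristic\<close>

text \<open>Pairs of distinct points are handled by the second moment method with density 1/q, and
  pairs (x, x) separately. Each part contributes at most q^k times the energy; (x + y)^2 <= 2 x^2 +
  2 y^2 joins them, whence the factor 4.\<close>

lemma sum_squares_bisector_deviation_le:
  assumes odd: "\<one> \<oplus> \<one> \<noteq> \<zero>" and k: "k \<ge> 2" and P: "P \<subseteq> vecs R k"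
  shows "(\<Sum>a\<in>vecs R k. (\<Sum>p\<in>P \<times> P. of_bool (a \<in> bisector k p) - 1 / real (order R))\<^sup>2)
       \<le> 4 * real (order R) ^ k * real (additive_energy R k P)"
proof -
  let ?d = "\<lambda>p. vec_diff R k (fst p) (snd p)" and ?q = "real (order R)" and ?V = "vecs R k"
  let ?\<Lambda> = "real (additive_energy R k P)"
  \<comment> \<open>The bisector of (x, x) is the whole space, so such pairs do not have density 1/q
    and are left out of \<open>M\<close>.\<close>
  define M where "M = {p \<in> P \<times> P. fst p \<noteq> snd p}"
  \<comment> \<open>The correlated pairs: those with parallel normals, including p' = p through l =
    1.\<close>
  define D where "D = {(p, p'). p \<in> M \<and> p' \<in> M \<and> (\<exists>l\<in>carrier R - {\<zero>}. ?d p' = vec_scale k l (?d p))}"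
  have fin: "finite P" using P finite_vecs finite_subset by blast
  then have finM: "finite M" by (auto simp: M_def)
  have q: "?q > 0" using order_pos by simp
  have Mv: "fst p \<in> ?V" "snd p \<in> ?V" "fst p \<noteq> snd p" if "p \<in> M" for p
    using that P by (auto simp: M_def)
  have hyp: "\<exists>c\<in>carrier R. bisector k p = hyperplane k (?d p) c" if "p \<in> M" for p
    using bisector_hyperplane[OF odd Mv(1,2)[OF that]] by auto
  have "(\<Sum>a\<in>?V. (\<Sum>p\<in>M. of_bool (a \<in> bisector k p) - 1 / ?q)\<^sup>2)
      \<le> real (card D) * (1 / ?q * real (card ?V))"
  proof (rule sum_squares_deviation_le)
    fix p assume p: "p \<in> M"
    obtain c where c: "c \<in> carrier R" "bisector k p = hyperplane k (?d p) c" using hyp[OF p] by auto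
    obtain i where i: "i < k" "?d p i \<noteq> \<zero>" using vec_diff_nonzero Mv[OF p] by metis
    have "card (bisector k p) = order R ^ (k - 1)"
      unfolding c(2) using Mv[OF p] i c by (intro card_hyperplane) auto
    then have "real (card (bisector k p)) = ?q ^ (k - 1)" by simp
    then show "real (card (bisector k p)) = 1 / ?q * real (card ?V)"
      using k q by (simp add: card_vecs power_diff)
    fix p' assume p': "p' \<in> M" and nD: "(p, p') \<notin> D"
    obtain c' where c': "bisector k p' = hyperplane k (?d p') c'" using hyp[OF p'] by auto
    obtain j where j: "j < k" "?d p' j \<noteq> \<zero>" using vec_diff_nonzero Mv[OF p'] by metis
    have v: "?d p \<in> ?V" "?d p' \<in> ?V" using Mv p p' by auto
    obtain i' j' where ij: "i' < k" "j' < k" "?d p i' \<otimes> ?d p' j' \<noteq> ?d p j' \<otimes> ?d p' i'"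
      using parallel_or_minor[OF v i j] nD p p' by (auto simp: D_def)
    have "card (bisector k p \<inter> bisector k p') \<le> order R ^ (k - 2)"
      unfolding c(2) c' by (rule card_hyperplane_Int_le[OF v ij])
    then have "real (card (bisector k p \<inter> bisector k p')) \<le> ?q ^ (k - 2)"
      by (simp only: of_nat_le_iff flip: of_nat_power)
    then show "real (card (bisector k p \<inter> bisector k p')) \<le> (1 / ?q)\<^sup>2 * real (card ?V)"
      using k q by (simp add: card_vecs power_diff power_divide)
  qed (auto simp: finM D_def bisector_def)
  \<comment> \<open>The q possible ratios of parallel normals cancel against the density 1/q of a
    hyperplane.\<close>
  also have "\<dots> \<le> (?q * ?\<Lambda>) * (1 / ?q * ?q ^ k)"
  proof -
    have "card D \<le> card {(p, p'). p \<in> P \<times> P \<and> p' \<in> P \<times> P \<and>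
        (\<exists>l\<in>carrier R - {\<zero>}. ?d p' = vec_scale k l (?d p))}"
      by (rule card_mono[OF finite_subset[of _ "(P \<times> P) \<times> (P \<times> P)"]])
        (use fin in \<open>auto simp: D_def M_def\<close>)
    then have "card D \<le> order R * additive_energy R k P"
      using card_parallel_pairs_le[OF P] by (rule order_trans)
    then have "real (card D) \<le> real (order R * additive_energy R k P)" by (rule of_nat_mono)
    then have "real (card D) \<le> ?q * ?\<Lambda>" by (simp only: of_nat_mult)
    then show ?thesis
      by (intro mult_mono) (auto simp: card_vecs)
  qed
  also have "\<dots> = ?q ^ k * ?\<Lambda>" using q by simp
  finally have off: "(\<Sum>a\<in>?V. (\<Sum>p\<in>M. of_bool (a \<in> bisector k p) - 1 / ?q)\<^sup>2) \<le> ?q ^ k * ?\<Lambda>" .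
  \<comment> \<open>Every centre is equidistant from x and x, so each of the |P| diagonal pairs
    contributes 1 - 1/q, independently of the centre.\<close>
  have split: "(\<Sum>p\<in>P \<times> P. of_bool (a \<in> bisector k p) - 1 / ?q)
      = real (card P) * (1 - 1 / ?q) + (\<Sum>p\<in>M. of_bool (a \<in> bisector k p) - 1 / ?q)"
    if a: "a \<in> ?V" for a
  proof -
    let ?f = "\<lambda>p. of_bool (a \<in> bisector k p) - 1 / ?q"
    have "P \<times> P = (\<lambda>x. (x, x)) ` P \<union> M" by (auto simp: M_def)
    then have "sum ?f (P \<times> P) = sum ?f ((\<lambda>x. (x, x)) ` P \<union> M)"
      by (rule arg_cong)
    also have "\<dots> = sum ?f ((\<lambda>x. (x, x)) ` P) + sum ?f M"
      using fin finM by (intro sum.union_disjoint) (auto simp: M_def)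
    also have "(\<Sum>p\<in>(\<lambda>x. (x, x)) ` P. of_bool (a \<in> bisector k p) - 1 / ?q) = real (card P) * (1 - 1 / ?q)"
      using a by (simp add: sum.reindex inj_on_def bisector_def)
    finally show ?thesis .
  qed
  have diag: "(real (card P) * (1 - 1 / ?q))\<^sup>2 \<le> ?\<Lambda>"
  proof -
    have "(real (card P) * (1 - 1 / ?q))\<^sup>2 \<le> (real (card P))\<^sup>2"
      using order_pos by (intro square_mult_one_minus_inverse_le) linarith
    also have "\<dots> \<le> ?\<Lambda>"
      using card_square_le_additive_energy[OF P] by (simp only: of_nat_le_iff flip: of_nat_power)
    finally show ?thesis .
  qed
  have "(\<Sum>a\<in>?V. (\<Sum>p\<in>P \<times> P. of_bool (a \<in> bisector k p) - 1 / ?q)\<^sup>2)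
      \<le> (\<Sum>a\<in>?V. 2 * ?\<Lambda> + 2 * (\<Sum>p\<in>M. of_bool (a \<in> bisector k p) - 1 / ?q)\<^sup>2)"
  proof (rule sum_mono)
    fix a assume a: "a \<in> ?V"
    show "(\<Sum>p\<in>P \<times> P. of_bool (a \<in> bisector k p) - 1 / ?q)\<^sup>2
        \<le> 2 * ?\<Lambda> + 2 * (\<Sum>p\<in>M. of_bool (a \<in> bisector k p) - 1 / ?q)\<^sup>2"
      unfolding split[OF a]
      using square_add_le[of "real (card P) * (1 - 1 / ?q)"
          "\<Sum>p\<in>M. of_bool (a \<in> bisector k p) - 1 / ?q"] diag
      by linarith
  qed
  also have "\<dots> = 2 * ?q ^ k * ?\<Lambda> + 2 * (\<Sum>a\<in>?V. (\<Sum>p\<in>M. of_bool (a \<in> bisector k p) - 1 / ?q)\<^sup>2)"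
    by (simp add: sum.distrib card_vecs flip: sum_distrib_left)
  also have "\<dots> \<le> 4 * ?q ^ k * ?\<Lambda>" using off by linarith
  finally show ?thesis .
qed

text \<open>The first Cauchy-Schwarz runs over the spheres. These are then grouped by centre, and
  each group is completed to all radii, which gives G(a). The second Cauchy-Schwarz runs over the
  centres that occur, and the sum of G(a)^2 is extended to all of the space.\<close>

lemma incidence_deviation_power4_le:
  assumes odd: "\<one> \<oplus> \<one> \<noteq> \<zero>" and k: "k \<ge> 2" and P: "P \<subseteq> vecs R k"
    and S: "finite S" "S \<subseteq> spheres R k"
  shows "(real (incidences P S) - real (card P) * real (card S) / real (order R)) ^ 4
       \<le> 4 * real (order R) ^ k * real (additive_energy R k P) * real (card S) ^ 3"
proof -
  let ?q = "real (order R)" and ?V = "vecs R k"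
  have fin: "finite P" using P finite_vecs finite_subset by blast
  \<comment> \<open>A sphere is only a point set, so one centre and one radius are chosen for
    each.\<close>
  have "\<forall>\<sigma>\<in>S. \<exists>c r. c \<in> ?V \<and> r \<in> carrier R \<and>
      (\<forall>x. x \<in> \<sigma> \<longleftrightarrow> x \<in> ?V \<and> vec_norm R k (vec_diff R k x c) = r)"
    using S(2) unfolding spheres_def sphere_at_def by blast
  then obtain c r where cr: "\<And>\<sigma>. \<sigma> \<in> S \<Longrightarrow> c \<sigma> \<in> ?V" "\<And>\<sigma>. \<sigma> \<in> S \<Longrightarrow> r \<sigma> \<in> carrier R"
    and mem: "\<And>\<sigma> x. \<sigma> \<in> S \<Longrightarrow>
      x \<in> \<sigma> \<longleftrightarrow> x \<in> ?V \<and> vec_norm R k (vec_diff R k x (c \<sigma>)) = r \<sigma>"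
    by metis
  define n where "n a x = vec_norm R k (vec_diff R k x a)" for a x
  define h where "h a t = (real (card {x \<in> P. n a x = t}) - real (card P) / ?q)\<^sup>2" for a t
  define G where "G a = (\<Sum>p\<in>P \<times> P. of_bool (a \<in> bisector k p) - 1 / ?q)" for a
  have G: "(\<Sum>t\<in>carrier R. h a t) = G a" if "a \<in> ?V" for a
  proof -
    have "(\<Sum>t\<in>carrier R. h a t) = (\<Sum>p\<in>P \<times> P. of_bool (n a (fst p) = n a (snd p)) - 1 / ?q)"
      unfolding h_def order_def using fin P that
      by (intro sum_squares_fiber_deviation) (auto simp: n_def)
    also have "\<dots> = G a"
      using that by (simp add: G_def bisector_def n_def)
    finally show ?thesis .
  qed
  define E where "E = real (incidences P S) - real (card P) * real (card S) / ?q"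
  have "E = (\<Sum>\<sigma>\<in>S. real (card (P \<inter> \<sigma>)) - real (card P) / ?q)"
    by (simp add: E_def incidences_eq_sum[OF fin S(1)] sum_subtractf mult.commute)
  then have "E\<^sup>2 \<le> real (card S) * (\<Sum>\<sigma>\<in>S. (real (card (P \<inter> \<sigma>)) - real (card P) / ?q)\<^sup>2)"
    using sum_squared_le_sum_of_squares[of "\<lambda>\<sigma>. real (card (P \<inter> \<sigma>)) - real (card P) / ?q" S]
    by (simp add: mult.commute)
  also have "(\<Sum>\<sigma>\<in>S. (real (card (P \<inter> \<sigma>)) - real (card P) / ?q)\<^sup>2) = (\<Sum>\<sigma>\<in>S. h (c \<sigma>) (r \<sigma>))"
  proof (rule sum.cong)
    fix \<sigma> assume "\<sigma> \<in> S"
    then have "P \<inter> \<sigma> = {x \<in> P. n (c \<sigma>) x = r \<sigma>}"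
      using P by (auto simp: mem n_def)
    then show "(real (card (P \<inter> \<sigma>)) - real (card P) / ?q)\<^sup>2 = h (c \<sigma>) (r \<sigma>)"
      by (simp add: h_def)
  qed simp
  also have "\<dots> = (\<Sum>a\<in>c ` S. \<Sum>\<sigma>\<in>{\<sigma> \<in> S. c \<sigma> = a}. h (c \<sigma>) (r \<sigma>))"
    by (rule sum.image_gen[OF S(1)])
  also have "\<dots> \<le> (\<Sum>a\<in>c ` S. \<Sum>t\<in>carrier R. h a t)"
  proof (rule sum_mono)
    fix a
    \<comment> \<open>Equal chosen centre and radius mean equal point sets, so spheres grouped at
      \<open>a\<close> occupy different radii. The other radii add only nonnegative terms.\<close>
    have inj: "inj_on r {\<sigma> \<in> S. c \<sigma> = a}"
      by (auto intro!: inj_onI simp: set_eq_iff mem)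
    have "(\<Sum>\<sigma>\<in>{\<sigma> \<in> S. c \<sigma> = a}. h (c \<sigma>) (r \<sigma>)) = (\<Sum>t\<in>r ` {\<sigma> \<in> S. c \<sigma> = a}. h a t)"
      using inj by (simp add: sum.reindex)
    also have "\<dots> \<le> (\<Sum>t\<in>carrier R. h a t)"
      by (rule sum_mono2) (use cr in \<open>auto simp: h_def\<close>)
    finally show "(\<Sum>\<sigma>\<in>{\<sigma> \<in> S. c \<sigma> = a}. h (c \<sigma>) (r \<sigma>)) \<le> (\<Sum>t\<in>carrier R. h a t)" .
  qed
  also have "\<dots> = (\<Sum>a\<in>c ` S. G a)"
    using G cr by (intro sum.cong) auto
  finally have E2: "E\<^sup>2 \<le> real (card S) * (\<Sum>a\<in>c ` S. G a)"
    by (simp add: mult_left_mono)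
  have "(\<Sum>a\<in>c ` S. G a)\<^sup>2 \<le> real (card (c ` S)) * (\<Sum>a\<in>c ` S. (G a)\<^sup>2)"
    using sum_squared_le_sum_of_squares[of G "c ` S"] by (simp add: mult.commute)
  \<comment> \<open>At most |S| centres occur, and the added terms are squares.\<close>
  also have "\<dots> \<le> real (card S) * (\<Sum>a\<in>?V. (G a)\<^sup>2)"
    by (intro mult_mono sum_mono2) (use cr S in \<open>auto intro: sum_nonneg card_image_le\<close>)
  also have "\<dots> \<le> real (card S) * (4 * ?q ^ k * real (additive_energy R k P))"
    using sum_squares_bisector_deviation_le[OF odd k P] by (simp add: G_def mult_left_mono)
  finally have G2: "(\<Sum>a\<in>c ` S. G a)\<^sup>2 \<le> real (card S) * (4 * ?q ^ k * real (additive_energy R k P))" .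
  have "E ^ 4 = (E\<^sup>2)\<^sup>2" by simp
  also have "\<dots> \<le> (real (card S) * (\<Sum>a\<in>c ` S. G a))\<^sup>2"
    using E2 by (intro power_mono) auto
  also have "\<dots> = (real (card S))\<^sup>2 * (\<Sum>a\<in>c ` S. G a)\<^sup>2"
    by (rule power_mult_distrib)
  also have "\<dots> \<le> (real (card S))\<^sup>2 * (real (card S) * (4 * ?q ^ k * real (additive_energy R k P)))"
    using G2 by (intro mult_left_mono) auto
  also have "\<dots> = 4 * ?q ^ k * real (additive_energy R k P) * real (card S) ^ 3"
    by (simp add: power2_eq_square power3_eq_cube)
  finally show ?thesis by (simp add: E_def)
qed

text \<open>In characteristic 2 the norm is additive, so all spheres are fibres of it, hence disjoint.\<close>

lemma incidence_deviation_le_char_2: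
  assumes even: "\<one> \<oplus> \<one> = \<zero>" and P: "P \<subseteq> vecs R k" and S: "finite S" "S \<subseteq> spheres R k"
  shows "\<bar>real (incidences P S) - real (card P) * real (card S) / real (order R)\<bar> \<le> real (card P)"
proof -
  let ?q = "real (order R)"
  define F where "F t = {x \<in> vecs R k. vec_norm R k x = t}" for t
  have fin: "finite P" using P finite_vecs finite_subset by blast
  have sphere: "\<exists>t\<in>carrier R. sphere_at R k a r = F t" if a: "a \<in> vecs R k" and r: "r \<in> carrier R" for a r
  proof
    have "vec_norm R k (vec_diff R k x a) = r \<longleftrightarrow> vec_norm R k x = r \<ominus> vec_norm R k a"
      if x: "x \<in> vecs R k" for x
    proof -
      have "vec_norm R k (vec_diff R k x a) = vec_norm R k x \<oplus> vec_norm R k a"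
        using vec_norm_diff[OF x a] even x a by simp
      moreover have "u \<oplus> w = r \<longleftrightarrow> u = r \<ominus> w" if "u \<in> carrier R" "w \<in> carrier R" for u w
        using that r by (auto simp: a_minus_def a_assoc l_neg r_neg)
      ultimately show ?thesis using x a by simp
    qed
    then show "sphere_at R k a r = F (r \<ominus> vec_norm R k a)"
      by (auto simp: sphere_at_def F_def)
  qed (use a r in auto)
  have SF: "S \<subseteq> F ` carrier R"
  proof
    fix \<sigma> assume "\<sigma> \<in> S"
    then obtain a r where "a \<in> vecs R k" "r \<in> carrier R" "\<sigma> = sphere_at R k a r"
      using S(2) unfolding spheres_def by blast
    then show "\<sigma> \<in> F ` carrier R" using sphere[of a r] by auto
  qed
  \<comment> \<open>There are at most q fibres, so |P| |S| / q is at most |P|. By disjointness the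
    incidences also number at most |P|, and two values in [0, |P|] differ by at most |P|.\<close>
  have "card S \<le> card (F ` carrier R)" using SF by (intro card_mono) auto
  also have "\<dots> \<le> order R" unfolding order_def by (rule card_image_le) simp
  finally have "real (card P) * real (card S) \<le> real (card P) * ?q"
    by (intro mult_left_mono) auto
  then have main: "real (card P) * real (card S) / ?q \<le> real (card P)"
    using order_pos by (simp add: field_simps)
  have disj: "(P \<inter> \<sigma>) \<inter> (P \<inter> \<tau>) = {}" if st: "\<sigma> \<in> S" "\<tau> \<in> S" "\<sigma> \<noteq> \<tau>" for \<sigma> \<tau>
  proof -
    obtain t t' where "\<sigma> = F t" "\<tau> = F t'" using SF st by blast
    then show ?thesis using st by (auto simp: F_def)
  qed
  have "incidences P S = card (\<Union>\<sigma>\<in>S. P \<inter> \<sigma>)"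
    unfolding incidences_eq_sum[OF fin S(1)]
    by (rule card_UN_disjoint[symmetric]) (use fin S disj in auto)
  also have "\<dots> \<le> card P" using fin by (intro card_mono) auto
  finally have "real (incidences P S) \<le> real (card P)" by simp
  moreover have "real (card P) * real (card S) / ?q \<ge> 0" by simp
  ultimately show ?thesis using main by linarith
qed

end

section \<open>Real exponents and the final constant\<close>

text \<open>Raising the size bound to the power 4s gives |P|^(4s) <= |L|^(4s) q^d. Hence the term
  |P|^4 / q^d of the Salem condition is absorbed by |P|^(4-4s), at the cost of a constant.\<close>

lemma salem4_energy_le:
  fixes s K L :: real
  assumes salem: "salem4 R d s K P" and s: "s > 0" and q: "order R > 0" and P: "card P > 0"
    and size: "real (card P) \<le> L * real (order R) powr (real d / (4 * s))"
  shows "real (additive_energy R d P) \<le> \<bar>K\<bar> * (1 + \<bar>L\<bar> powr (4 * s)) * real (card P) powr (4 - 4 * s)"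
proof -
  let ?n = "real (card P)" and ?q = "real (order R)"
  have n: "?n > 0" and q0: "?q > 0" using P q by auto
  \<comment> \<open>The constants \<open>K\<close> and \<open>L\<close> may have any sign; passing
    to absolute values keeps the bases of the powers nonnegative.\<close>
  have "L * ?q powr (real d / (4 * s)) \<le> \<bar>L\<bar> * ?q powr (real d / (4 * s))"
    by (intro mult_right_mono) auto
  then have "?n powr (4 * s) \<le> (\<bar>L\<bar> * ?q powr (real d / (4 * s))) powr (4 * s)"
    using size s n by (intro powr_mono2) linarith+
  also have "\<dots> = \<bar>L\<bar> powr (4 * s) * ?q ^ d"
    using s q0 by (simp add: powr_mult powr_powr powr_realpow)
  finally have ns: "?n powr (4 * s) \<le> \<bar>L\<bar> powr (4 * s) * ?q ^ d" .
  have "?n ^ 4 = ?n powr (4 - 4 * s) * ?n powr (4 * s)"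
    using n by (simp add: powr_numeral flip: powr_add)
  also have "\<dots> \<le> ?n powr (4 - 4 * s) * (\<bar>L\<bar> powr (4 * s) * ?q ^ d)"
    using ns by (intro mult_left_mono) auto
  finally have n4: "?n ^ 4 / ?q ^ d \<le> \<bar>L\<bar> powr (4 * s) * ?n powr (4 - 4 * s)"
    using q0 by (simp add: divide_le_eq mult_ac)
  have "real (additive_energy R d P) \<le> K * (?n powr (4 - 4 * s) + ?n ^ 4 / ?q ^ d)"
    using salem by (simp add: salem4_def)
  also have "\<dots> \<le> \<bar>K\<bar> * (?n powr (4 - 4 * s) + ?n ^ 4 / ?q ^ d)"
    by (intro mult_right_mono) auto
  also have "\<dots> \<le> \<bar>K\<bar> * (?n powr (4 - 4 * s) + \<bar>L\<bar> powr (4 * s) * ?n powr (4 - 4 * s))"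
    using n4 by (intro mult_left_mono) auto
  also have "\<dots> = \<bar>K\<bar> * (1 + \<bar>L\<bar> powr (4 * s)) * ?n powr (4 - 4 * s)"
    by (simp add: algebra_simps)
  finally show ?thesis .
qed

lemma abs_le_of_power4_le:
  fixes E C A q n m :: real
  assumes E: "E ^ 4 \<le> A * (q ^ d * n powr (4 - 4 * s) * m ^ 3)"
    and C: "C \<ge> 1" "A \<le> C" and pos: "q > 0" "n > 0" "m > 0"
  shows "\<bar>E\<bar> \<le> C * (q powr (real d / 4) * n powr (1 - s) * m powr (3 / 4))"
proof -
  let ?X = "C * (q powr (real d / 4) * n powr (1 - s) * m powr (3 / 4))"
  have pw: "(x powr a) ^ 4 = x powr (4 * a)" if "x > 0" for x a :: real
    using that by (simp add: powr_realpow[symmetric] powr_powr mult.commute)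
  have X4: "?X ^ 4 = C ^ 4 * (q ^ d * n powr (4 - 4 * s) * m ^ 3)"
  proof -
    have "(q powr (real d / 4)) ^ 4 = q ^ d" "(n powr (1 - s)) ^ 4 = n powr (4 - 4 * s)"
      "(m powr (3 / 4)) ^ 4 = m ^ 3"
      using pos by (simp_all add: pw powr_realpow algebra_simps)
    then show ?thesis by (simp only: power_mult_distrib)
  qed
  \<comment> \<open>Since C >= 1, the fourth power of \<open>C\<close> dominates \<open>A\<close>;
    no fourth root of \<open>A\<close> has to enter the constant.\<close>
  have "C ^ 1 \<le> C ^ 4" using C by (intro power_increasing) auto
  then have "A \<le> C ^ 4" using C by simp
  then have "A * (q ^ d * n powr (4 - 4 * s) * m ^ 3) \<le> C ^ 4 * (q ^ d * n powr (4 - 4 * s) * m ^ 3)"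
    using pos by (intro mult_right_mono) auto
  with E have "\<bar>E\<bar> ^ Suc 3 \<le> ?X ^ Suc 3" using X4 by simp
  then show ?thesis
    by (rule power_le_imp_le_base) (use C pos in auto)
qed

text \<open>This turns the bound |P| of characteristic 2 into the required form: the size bound
  gives n^s <= |L|^s q^(d/4), which is multiplied by n^(1-s), and m^(3/4) >= 1.\<close>

lemma le_of_size_le:
  fixes L s q n m C :: real
  assumes size: "n \<le> L * q powr (real d / (4 * s))" and s: "s > 0"
    and pos: "q > 0" "n > 0" and m: "m \<ge> 1" and C: "\<bar>L\<bar> powr s \<le> C"
  shows "n \<le> C * (q powr (real d / 4) * n powr (1 - s) * m powr (3 / 4))"
proof -
  have "L * q powr (real d / (4 * s)) \<le> \<bar>L\<bar> * q powr (real d / (4 * s))"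
    by (intro mult_right_mono) auto
  then have "n powr s \<le> (\<bar>L\<bar> * q powr (real d / (4 * s))) powr s"
    using size s pos by (intro powr_mono2) linarith+
  also have "\<dots> = \<bar>L\<bar> powr s * q powr (real d / 4)"
    using s by (simp add: powr_mult powr_powr)
  also have "\<dots> \<le> C * q powr (real d / 4)"
    using C by (intro mult_right_mono) auto
  finally have ns: "n powr s \<le> C * q powr (real d / 4)" .
  have "1 \<le> m powr (3 / 4)" using m by (intro ge_one_powr_ge_zero) auto
  then have m1: "n powr (1 - s) * 1 \<le> n powr (1 - s) * m powr (3 / 4)"
    by (intro mult_left_mono) auto
  have "0 \<le> C * q powr (real d / 4)"
    using ns powr_ge_zero order_trans by blast
  then have "n powr s * (n powr (1 - s) * 1)
      \<le> (C * q powr (real d / 4)) * (n powr (1 - s) * m powr (3 / 4))"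
    by (intro mult_mono[OF ns m1]) auto
  moreover have "n powr s * n powr (1 - s) = n"
    using pos by (simp flip: powr_add)
  ultimately show ?thesis by (simp add: mult.assoc)
qed

theorem theorem1p7:
  fixes d :: nat and s K L :: real
  assumes "d \<ge> 2" and "1/4 < s" and "s \<le> 1/2"
  shows "\<exists>C>0. \<forall>(R :: 'a ring) (P :: (nat \<Rightarrow> 'a) set) (S :: (nat \<Rightarrow> 'a) set set).
    field R \<longrightarrow> finite (carrier R) \<longrightarrow>
    salem4 R d s K P \<longrightarrow>
    real (card P) \<le> L * real (order R) powr (real d / (4 * s)) \<longrightarrow>
    finite S \<longrightarrow> S \<subseteq> spheres R d \<longrightarrow>
    \<bar>real (incidences P S) - real (card P) * real (card S) / real (order R)\<bar>
      \<le> C * (real (order R) powr (real d / 4) * real (card P) powr (1 - s) * real (card S) powr (3/4))"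
proof -
  \<comment> \<open>The factor 4 comes from \<open>incidence_deviation_power4_le\<close>, the rest
    from \<open>salem4_energy_le\<close>.\<close>
  define A where "A = 4 * (\<bar>K\<bar> * (1 + \<bar>L\<bar> powr (4 * s)))"
  \<comment> \<open>The three summands make \<open>C\<close> at least 1 and at least
    \<open>A\<close> for odd characteristic, and at least |L|^s for characteristic 2.\<close>
  define C where "C = 1 + A + \<bar>L\<bar> powr s"
  have A: "A \<ge> 0" unfolding A_def by (intro mult_nonneg_nonneg add_nonneg_nonneg) auto
  then have C: "C \<ge> 1" "A \<le> C" "\<bar>L\<bar> powr s \<le> C" by (auto simp: C_def)
  show ?thesis
  proof (intro exI[of _ C] conjI allI impI)
    show "C > 0" using C by simp
  next
    fix R :: "'a ring" and P :: "(nat \<Rightarrow> 'a) set" and S :: "(nat \<Rightarrow> 'a) set set"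
    assume "field R" "finite (carrier R)" and salem: "salem4 R d s K P"
      and size: "real (card P) \<le> L * real (order R) powr (real d / (4 * s))"
      and S: "finite S" "S \<subseteq> spheres R d"
    then interpret finite_field R
      by (simp add: finite_field_def finite_field_axioms_def)
    let ?n = "real (card P)" and ?m = "real (card S)" and ?q = "real (order R)"
    let ?E = "real (incidences P S) - ?n * ?m / ?q"
    have P: "P \<subseteq> vecs R d" using salem by (simp add: salem4_def)
    then have fin: "finite P" using finite_vecs finite_subset by blast
    have q: "?q > 0" using order_pos by simp
    show "\<bar>?E\<bar> \<le> C * (?q powr (real d / 4) * ?n powr (1 - s) * ?m powr (3/4))"
    \<comment> \<open>The manipulations of powers below use |P| > 0 and |S| >= 1; if one of the sets
      is empty, the deviation is 0.\<close>
    proof (cases "P = {} \<or> S = {}")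
      case True
      then have "?E = 0" by (auto simp: incidences_def)
      then show ?thesis using C by simp
    next
      case False
      then have n: "?n > 0" and m: "?m \<ge> 1"
        using fin S by (auto simp: card_gt_0_iff Suc_le_eq)
      show ?thesis
      proof (cases "\<one>\<^bsub>R\<^esub> \<oplus>\<^bsub>R\<^esub> \<one>\<^bsub>R\<^esub> = \<zero>\<^bsub>R\<^esub>")
        case True
        then have "\<bar>?E\<bar> \<le> ?n" using P S by (rule incidence_deviation_le_char_2)
        also have "?n \<le> C * (?q powr (real d / 4) * ?n powr (1 - s) * ?m powr (3/4))"
          using assms C by (intro le_of_size_le[OF size _ q n m]) auto
        finally show ?thesis .
      next
        case odd: False
        have "real (additive_energy R d P) \<le> A / 4 * ?n powr (4 - 4 * s)"
          using salem4_energy_le[OF salem _ order_pos _ size] n assms by (simp add: A_def)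
        then have "4 * ?q ^ d * real (additive_energy R d P) * ?m ^ 3
            \<le> 4 * ?q ^ d * (A / 4 * ?n powr (4 - 4 * s)) * ?m ^ 3"
          by (intro mult_right_mono mult_left_mono) auto
        with incidence_deviation_power4_le[OF odd assms(1) P S]
        have "?E ^ 4 \<le> A * (?q ^ d * ?n powr (4 - 4 * s) * ?m ^ 3)"
          by (simp add: mult_ac)
        from abs_le_of_power4_le[OF this C(1,2) q n] m show ?thesis by linarith
      qed
    qed
  qed
qed

end
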